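(* Let $G$ be a topological group, let $(V,\tau)$ be a conic representation of $G$, and let $Q=L^{-1}(1)\subseteq V$ be a compact section of $V$. Let $\rho:G\times Q\to Q$ be the action of $G$ on $Q$ induced by $\tau$, and let $\sigma:G\times Q\to\mathbb{R}_{>0}$ be the unique function satisfying $\tau_g(x)=\sigma(g,x)\rho_g(x)$ for all $g\in G$, $x\in Q$. Then $\sigma$ is a multiplier of $G$ and $Q$ (relative to $\rho$).
   Context: Topological linear spaces (real or complex) are Hausdorff. A cone $V$ is a subset of a topological linear space $X$ with point-separating continuous dual such that $ax+by\in V$ for all $x,y\in V$, $a,b\ge 0$. A conic function on $V$ is a real- or complex-valued function preserving non-negative linear combinations. A section of $V$ is a set $Q=L^{-1}(1)$, where $L:V\to\mathbb{R}_{\ge 0}$ is a continuous conic function with $L(x)>0$ for all $x\in V\setminus\{0\}$. A conic representation $(V,\tau)$ of $G$ consists of a non-zero cone $V$ admitting a compact section (then all sections are compact) and a continuous map $\tau:G\times V\to V$ with $\tau_e=\mathrm{id}_V$, $\tau_{g_1g_2}=\tau_{g_1}\circ\tau_{g_2}$, and each $\tau_g$ preserving non-negative linear combinations. The induced action on the section $Q=L^{-1}(1)$ is $\rho_g(x)=\tau_g(x)/L(\tau_g(x))$. Given a topological space $M$ with a continuous action $\rho$ of $G$, a multiplier of $G$ and $M$ (relative to $\rho$) is a continuous function $\sigma:G\times M\to\mathbb{R}_{>0}$ with $\sigma(g\gamma,x)=\sigma(g,\rho_\gamma(x))\,\sigma(\gamma,x)$ for all $g,\gamma\in G$, $x\in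 M$. *)

theory Defs
  imports "HOL-Analysis.Analysis" "HOL-Algebra.Group"
begin

definition topological_group :: "('g, 'r) monoid_scheme \<Rightarrow> 'g topology \<Rightarrow> bool" where
  "topological_group G T \<longleftrightarrow>
     group G \<and> topspace T = carrier G \<and>
     continuous_map (prod_topology T T) T (\<lambda>(g, h). g \<otimes>\<^bsub>G\<^esub> h) \<and>
     continuous_map T T (\<lambda>g. inv\<^bsub>G\<^esub> g)"

text \<open>The scalar field is any type of class \<^class>\<open>real_normed_field\<close>. By the Gelfand-Mazur
  theorem such a field is the reals or the complex numbers, so this covers exactly the real and
  the complex case. The space itself is the whole type \<open>'v\<close>; the Hausdorff property and the
  continuity of addition come from its classes.\<close>

locale topological_linear_space = vector_space sc
  for sc :: "'k::real_normed_field \<Rightarrow> 'v::{topological_ab_group_add, t2_space} \<Rightarrow> 'v" +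
  assumes continuous_scale: "continuous_on UNIV (\<lambda>(a, x). sc a x)"

definition continuous_dual ::
    "('k::real_normed_field \<Rightarrow> 'v::{topological_ab_group_add, t2_space} \<Rightarrow> 'v) \<Rightarrow> ('v \<Rightarrow> 'k) set" where
  "continuous_dual sc = {f. Vector_Spaces.linear sc (*) f \<and> continuous_on UNIV f}"

definition topological_cone ::
    "('k::real_normed_field \<Rightarrow> 'v::{topological_ab_group_add, t2_space} \<Rightarrow> 'v) \<Rightarrow> 'v set \<Rightarrow> bool" where
  "topological_cone sc V \<longleftrightarrow>
     topological_linear_space sc \<and>
     (\<forall>x y. x \<noteq> y \<longrightarrow> (\<exists>f\<in>continuous_dual sc. f x \<noteq> f y)) \<and>
     (\<forall>x\<in>V. \<forall>y\<in>V. \<forall>a\<ge>0. \<forall>b\<ge>0. sc (of_real a) x + sc (of_real b) y \<in> V)"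

definition preserves_conic_combinations ::
    "('k::real_normed_field \<Rightarrow> 'v::ab_group_add \<Rightarrow> 'v) \<Rightarrow>
     ('l::real_normed_field \<Rightarrow> 'w::ab_group_add \<Rightarrow> 'w) \<Rightarrow> 'v set \<Rightarrow> ('v \<Rightarrow> 'w) \<Rightarrow> bool" where
  "preserves_conic_combinations sc sc' V f \<longleftrightarrow>
     (\<forall>x\<in>V. \<forall>y\<in>V. \<forall>a\<ge>0. \<forall>b\<ge>0.
        f (sc (of_real a) x + sc (of_real b) y) =
          sc' (of_real a) (f x) + sc' (of_real b) (f y))"

definition conic_function ::
    "('k::real_normed_field \<Rightarrow> 'v::ab_group_add \<Rightarrow> 'v) \<Rightarrow> 'v set \<Rightarrow> ('v \<Rightarrow> 'l::real_normed_field) \<Rightarrow> bool" where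
  "conic_function sc V f \<longleftrightarrow> preserves_conic_combinations sc (*) V f"

definition section_of ::
    "('k::real_normed_field \<Rightarrow> 'v::{topological_ab_group_add, t2_space} \<Rightarrow> 'v) \<Rightarrow>
     'v set \<Rightarrow> ('v \<Rightarrow> real) \<Rightarrow> 'v set \<Rightarrow> bool" where
  "section_of sc V L Q \<longleftrightarrow>
     continuous_on V L \<and> conic_function sc V L \<and>
     (\<forall>x\<in>V. L x \<ge> 0) \<and> (\<forall>x\<in>V - {0}. L x > 0) \<and>
     Q = {x\<in>V. L x = 1}"

definition conic_representation ::
    "('g, 'r) monoid_scheme \<Rightarrow> 'g topology \<Rightarrow>
     ('k::real_normed_field \<Rightarrow> 'v::{topological_ab_group_add, t2_space} \<Rightarrow> 'v) \<Rightarrow>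
     'v set \<Rightarrow> ('g \<Rightarrow> 'v \<Rightarrow> 'v) \<Rightarrow> bool" where
  "conic_representation G T sc V \<tau> \<longleftrightarrow>
     topological_cone sc V \<and> (\<exists>x\<in>V. x \<noteq> 0) \<and>
     (\<exists>L Q. section_of sc V L Q \<and> compact Q) \<and>
     continuous_map (prod_topology T (top_of_set V)) (top_of_set V) (\<lambda>(g, x). \<tau> g x) \<and>
     (\<forall>x\<in>V. \<tau> \<one>\<^bsub>G\<^esub> x = x) \<and>
     (\<forall>g\<in>carrier G. \<forall>h\<in>carrier G. \<forall>x\<in>V. \<tau> (g \<otimes>\<^bsub>G\<^esub> h) x = \<tau> g (\<tau> h x)) \<and>
     (\<forall>g\<in>carrier G. preserves_conic_combinations sc sc V (\<tau> g))"

definition induced_action ::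
    "('k::real_normed_field \<Rightarrow> 'v::{topological_ab_group_add, t2_space} \<Rightarrow> 'v) \<Rightarrow>
     ('v \<Rightarrow> real) \<Rightarrow> ('g \<Rightarrow> 'v \<Rightarrow> 'v) \<Rightarrow> 'g \<Rightarrow> 'v \<Rightarrow> 'v" where
  "induced_action sc L \<tau> g x = sc (of_real (1 / L (\<tau> g x))) (\<tau> g x)"

definition continuous_action ::
    "('g, 'r) monoid_scheme \<Rightarrow> 'g topology \<Rightarrow> 'm topology \<Rightarrow> ('g \<Rightarrow> 'm \<Rightarrow> 'm) \<Rightarrow> bool" where
  "continuous_action G T M \<rho> \<longleftrightarrow>
     continuous_map (prod_topology T M) M (\<lambda>(g, x). \<rho> g x) \<and>
     (\<forall>x\<in>topspace M. \<rho> \<one>\<^bsub>G\<^esub> x = x) \<and>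
     (\<forall>g\<in>carrier G. \<forall>h\<in>carrier G. \<forall>x\<in>topspace M. \<rho> (g \<otimes>\<^bsub>G\<^esub> h) x = \<rho> g (\<rho> h x))"

text \<open>The notion presupposes that \<open>\<rho>\<close> is a continuous action; this is part of the predicate.\<close>

definition multiplier ::
    "('g, 'r) monoid_scheme \<Rightarrow> 'g topology \<Rightarrow> 'm topology \<Rightarrow> ('g \<Rightarrow> 'm \<Rightarrow> 'm) \<Rightarrow>
     ('g \<Rightarrow> 'm \<Rightarrow> real) \<Rightarrow> bool" where
  "multiplier G T M \<rho> \<sigma> \<longleftrightarrow>
     continuous_action G T M \<rho> \<and>
     continuous_map (prod_topology T M) (top_of_set {0<..}) (\<lambda>(g, x). \<sigma> g x) \<and>
     (\<forall>g\<in>carrier G. \<forall>\<gamma>\<in>carrier G. \<forall>x\<in>topspace M.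
        \<sigma> (g \<otimes>\<^bsub>G\<^esub> \<gamma>) x = \<sigma> g (\<rho> \<gamma> x) * \<sigma> \<gamma> x)"

end

theory Submission
  imports Defs
begin

text \<open>Applying \<open>L\<close> to \<open>\<tau> g x = \<sigma> g x \<rho> g x\<close> gives \<open>\<sigma> g x = L (\<tau> g x)\<close>, which makes continuity evident.
  Positive homogeneity of \<open>\<tau> g\<close> gives \<open>\<tau> (g h) x = \<sigma> h x \<tau> g (\<rho> h x)\<close>; applying \<open>L\<close> again yields
  the multiplier identity, and normalising yields the action law for \<open>\<rho>\<close>.\<close>

lemma preserves_conic_combinations_scale:
  assumes "vector_space sc" "vector_space sc'" "preserves_conic_combinations sc sc' V f"
    and "x \<in> V" "a \<ge> 0"
  shows "f (sc (of_real a) x) = sc' (of_real a) (f x)"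
proof -
  interpret d: vector_space sc by fact
  interpret c: vector_space sc' by fact
  \<comment> \<open>The coefficient 0 kills the second summand on both sides, so the two-term law
    specialises to homogeneity.\<close>
  have "f (sc (of_real a) x + sc (of_real 0) x) = sc' (of_real a) (f x) + sc' (of_real 0) (f x)"
    using assms unfolding preserves_conic_combinations_def by blast
  then show ?thesis by simp
qed

lemma conic_function_scale:
  assumes "vector_space sc" "conic_function sc V f" "x \<in> V" "a \<ge> 0"
  shows "f (sc (of_real a) x) = of_real a * f x"
proof -
  \<comment> \<open>The field of values is a vector space over itself, which brings
    \<open>conic_function\<close> under the preceding lemma.\<close>
  have "vector_space ((*) :: 'c \<Rightarrow> 'c \<Rightarrow> 'c::real_normed_field)"
    by unfold_locales (simp_all add: algebra_simps)
  then show ?thesis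
    using assms preserves_conic_combinations_scale unfolding conic_function_def by blast
qed

lemma topological_cone_scale:
  assumes "topological_cone sc V" "x \<in> V" "a \<ge> 0"
  shows "sc (of_real a) x \<in> V"
proof -
  interpret topological_linear_space sc
    using assms unfolding topological_cone_def by blast
  have "sc (of_real a) x + sc (of_real 0) x \<in> V"
    using assms unfolding topological_cone_def by blast
  then show ?thesis by simp
qed

text \<open>Reduces continuity of the normalised action \<rho> to continuity of the normalising
  factor and of \<tau>. It holds because scalar multiplication is jointly continuous and real
  numbers embed continuously in the field.\<close>

lemma continuous_map_scale:
  fixes sc :: "'k::real_normed_field \<Rightarrow> 'v::{topological_ab_group_add, t2_space} \<Rightarrow> 'v"
  assumes "topological_linear_space sc"
    and "continuous_map X euclideanreal a" and "continuous_map X euclidean f"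
  shows "continuous_map X euclidean (\<lambda>x. sc (of_real (a x)) (f x))"
proof -
  have "continuous_map euclideanreal euclidean (of_real :: real \<Rightarrow> 'k)"
    by (simp add: continuous_on_of_real)
  from continuous_map_compose[OF assms(2) this]
  have "continuous_map X euclidean (\<lambda>x. of_real (a x) :: 'k)"
    by (simp add: o_def)
  then have "continuous_map X (prod_topology euclidean euclidean) (\<lambda>x. (of_real (a x) :: 'k, f x))"
    using assms(3) by (rule continuous_map_pairedI)
  then have pair: "continuous_map X euclidean (\<lambda>x. (of_real (a x) :: 'k, f x))"
    by simp
  have "continuous_map euclidean euclidean (\<lambda>(a, x). sc a x)"
    using topological_linear_space.continuous_scale[OF assms(1)] by simp
  from continuous_map_compose[OF pair this] show ?thesis
    by (simp add: o_def)
qed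

text \<open>Each \<tau> g is injective on V, being undone by the action of the inverse of g. That
  inverse map fixes 0 by homogeneity with factor 0, so \<tau> g x = 0 would force x = 0. This keeps
  the normalisation by L away from a zero denominator.\<close>

lemma conic_representation_nonzero:
  assumes "group G" "conic_representation G T sc V \<tau>" "topspace T = carrier G"
    and "g \<in> carrier G" "x \<in> V" "x \<noteq> 0"
  shows "\<tau> g x \<in> V" "\<tau> g x \<noteq> 0"
proof -
  interpret group G by fact
  have rep: "topological_cone sc V" "\<tau> \<one>\<^bsub>G\<^esub> x = x"
    "\<And>h. h \<in> carrier G \<Longrightarrow> \<tau> (h \<otimes>\<^bsub>G\<^esub> g) x = \<tau> h (\<tau> g x)"
    "\<And>h. h \<in> carrier G \<Longrightarrow> preserves_conic_combinations sc sc V (\<tau> h)"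
    and cont: "continuous_map (prod_topology T (top_of_set V)) (top_of_set V) (\<lambda>(g, x). \<tau> g x)"
    using assms unfolding conic_representation_def by blast+
  interpret topological_linear_space sc
    using rep unfolding topological_cone_def by blast
  \<comment> \<open>Invariance of V is encoded in the codomain \<open>top_of_set V\<close> of the
    continuous map.\<close>
  show "\<tau> g x \<in> V"
    using continuous_map_funspace[OF cont] assms by (auto simp: Pi_iff)
  have "vector_space sc" ..
  show "\<tau> g x \<noteq> 0"
  proof
    assume "\<tau> g x = 0"
    moreover have "\<tau> (inv\<^bsub>G\<^esub> g) 0 = 0"
      using preserves_conic_combinations_scale[of sc sc V "\<tau> (inv\<^bsub>G\<^esub> g)" x 0]
        rep(4)[of "inv\<^bsub>G\<^esub> g"] assms \<open>vector_space sc\<close> by simp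
    ultimately show False
      using rep(3)[of "inv\<^bsub>G\<^esub> g"] rep(2) assms by simp
  qed
qed

theorem proposition9:
  fixes G :: "('g, 'r) monoid_scheme" and T :: "'g topology"
    and sc :: "'k::real_normed_field \<Rightarrow> 'v::{topological_ab_group_add, t2_space} \<Rightarrow> 'v"
    and V Q :: "'v set" and \<tau> \<rho> :: "'g \<Rightarrow> 'v \<Rightarrow> 'v"
    and L :: "'v \<Rightarrow> real" and \<sigma> :: "'g \<Rightarrow> 'v \<Rightarrow> real"
  assumes "topological_group G T"
    and "conic_representation G T sc V \<tau>"
    and "section_of sc V L Q" and "compact Q"
    and "\<And>g x. g \<in> carrier G \<Longrightarrow> x \<in> Q \<Longrightarrow> \<rho> g x = induced_action sc L \<tau> g x"
    and "\<And>g x. g \<in> carrier G \<Longrightarrow> x \<in> Q \<Longrightarrow> \<sigma> g x > 0"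
    and "\<And>g x. g \<in> carrier G \<Longrightarrow> x \<in> Q \<Longrightarrow> \<tau> g x = sc (of_real (\<sigma> g x)) (\<rho> g x)"
  shows "multiplier G T (top_of_set Q) \<rho> \<sigma>"
proof -
  have grp: "group G" and T: "topspace T = carrier G"
    using assms(1) unfolding topological_group_def by auto
  interpret G: group G by fact
  have cone: "topological_cone sc V"
    and \<tau>_cont: "continuous_map (prod_topology T (top_of_set V)) (top_of_set V) (\<lambda>(g, x). \<tau> g x)"
    and \<tau>_one: "\<And>x. x \<in> V \<Longrightarrow> \<tau> \<one>\<^bsub>G\<^esub> x = x"
    and \<tau>_mult: "\<And>g h x. \<lbrakk>g \<in> carrier G; h \<in> carrier G; x \<in> V\<rbrakk> \<Longrightarrow> \<tau> (g \<otimes>\<^bsub>G\<^esub> h) x = \<tau> g (\<tau> h x)"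
    and \<tau>_conic: "\<And>g. g \<in> carrier G \<Longrightarrow> preserves_conic_combinations sc sc V (\<tau> g)"
    using assms(2) unfolding conic_representation_def by blast+
  interpret topological_linear_space sc
    using cone unfolding topological_cone_def by blast
  have vs: "vector_space sc" ..
  have L_cont: "continuous_on V L" and L_conic: "conic_function sc V L"
    and L_pos: "\<And>x. \<lbrakk>x \<in> V; x \<noteq> 0\<rbrakk> \<Longrightarrow> L x > 0" and Q: "Q = {x \<in> V. L x = 1}"
    using assms(3) unfolding section_of_def by auto
  have L_scale: "L (sc (of_real a) x) = a * L x" if "x \<in> V" "a \<ge> 0" for a x
    using conic_function_scale[OF vs L_conic that] by simp
  have Q_V: "x \<in> V" and L_Q: "L x = 1" if "x \<in> Q" for x
    using that Q by auto
  \<comment> \<open>Homogeneity with factor 0 gives L 0 = 0, whereas L is 1 on Q.\<close>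
  have Q_nz: "x \<noteq> 0" if "x \<in> Q" for x
    using L_scale[OF Q_V[OF that], of 0] L_Q[OF that] by auto
  have \<tau>_V: "\<tau> g x \<in> V" and L\<tau>_pos: "L (\<tau> g x) > 0" if "g \<in> carrier G" "x \<in> Q" for g x
    using conic_representation_nonzero[OF grp assms(2) T that(1) Q_V[OF that(2)] Q_nz[OF that(2)]]
      L_pos by auto
  have \<rho>_eq: "\<rho> g x = sc (of_real (1 / L (\<tau> g x))) (\<tau> g x)" if "g \<in> carrier G" "x \<in> Q" for g x
    using assms(5)[OF that] by (simp add: induced_action_def)
  have \<rho>_Q: "\<rho> g x \<in> Q" if "g \<in> carrier G" "x \<in> Q" for g x
  proof -
    have "\<rho> g x \<in> V"
      using topological_cone_scale[OF cone \<tau>_V[OF that], of "1 / L (\<tau> g x)"] L\<tau>_pos[OF that]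
      unfolding \<rho>_eq[OF that] by simp
    moreover have "L (\<rho> g x) = 1"
      using L_scale[OF \<tau>_V[OF that], of "1 / L (\<tau> g x)"] L\<tau>_pos[OF that]
      unfolding \<rho>_eq[OF that] by simp
    ultimately show ?thesis using Q by simp
  qed
  \<comment> \<open>Since L is homogeneous for nonnegative factors, positivity of \<sigma> lets the
    factor be pulled out; what remains is L (\<rho> g x) = 1.\<close>
  have \<sigma>_eq: "\<sigma> g x = L (\<tau> g x)" if "g \<in> carrier G" "x \<in> Q" for g x
    using assms(6,7)[OF that] L_scale[of "\<rho> g x" "\<sigma> g x"] \<rho>_Q[OF that] Q_V L_Q by simp
  have \<tau>_split: "\<tau> (g \<otimes>\<^bsub>G\<^esub> h) x = sc (of_real (\<sigma> h x)) (\<tau> g (\<rho> h x))"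
    if "g \<in> carrier G" "h \<in> carrier G" "x \<in> Q" for g h x
    using that \<tau>_mult[OF that(1,2) Q_V] assms(6,7)[OF that(2,3)] \<rho>_Q Q_V
      preserves_conic_combinations_scale[OF vs vs \<tau>_conic[OF that(1)]]
    by (simp add: less_imp_le)
  have cocycle: "\<sigma> (g \<otimes>\<^bsub>G\<^esub> h) x = \<sigma> g (\<rho> h x) * \<sigma> h x"
    if "g \<in> carrier G" "h \<in> carrier G" "x \<in> Q" for g h x
    using that \<tau>_split[OF that] L_scale[OF \<tau>_V[OF that(1) \<rho>_Q[OF that(2,3)]], of "\<sigma> h x"]
      assms(6)[OF that(2,3)] \<rho>_Q by (simp add: \<sigma>_eq)
  have \<rho>_one: "\<rho> \<one>\<^bsub>G\<^esub> x = x" if "x \<in> Q" for x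
    using that \<rho>_eq[OF G.one_closed that] \<tau>_one[OF Q_V[OF that]] L_Q by simp
  have \<rho>_mult: "\<rho> (g \<otimes>\<^bsub>G\<^esub> h) x = \<rho> g (\<rho> h x)"
    if "g \<in> carrier G" "h \<in> carrier G" "x \<in> Q" for g h x
  proof -
    have pos: "\<sigma> h x > 0" "\<sigma> g (\<rho> h x) > 0"
      using assms(6) that \<rho>_Q by auto
    \<comment> \<open>The cocycle identity rewrites the denominator and \<open>\<tau>_split\<close>
      the vector. The factor \<sigma> h x then cancels, leaving exactly the normaliser of \<tau> g
      (\<rho> h x).\<close>
    have "\<rho> (g \<otimes>\<^bsub>G\<^esub> h) x
        = sc (of_real (1 / (\<sigma> g (\<rho> h x) * \<sigma> h x))) (sc (of_real (\<sigma> h x)) (\<tau> g (\<rho> h x)))"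
      using \<rho>_eq[of "g \<otimes>\<^bsub>G\<^esub> h" x] \<sigma>_eq[of "g \<otimes>\<^bsub>G\<^esub> h" x] cocycle[OF that] \<tau>_split[OF that] that
      by simp
    also have "\<dots> = sc (of_real (1 / (\<sigma> g (\<rho> h x) * \<sigma> h x) * \<sigma> h x)) (\<tau> g (\<rho> h x))"
      unfolding of_real_mult scale_scale ..
    also have "1 / (\<sigma> g (\<rho> h x) * \<sigma> h x) * \<sigma> h x = 1 / L (\<tau> g (\<rho> h x))"
      using pos \<sigma>_eq[OF that(1) \<rho>_Q[OF that(2,3)]] by simp
    finally show ?thesis
      using \<rho>_eq[OF that(1) \<rho>_Q[OF that(2,3)]] by simp
  qed
  let ?P = "prod_topology T (top_of_set Q)"
  have top: "topspace ?P = carrier G \<times> Q" by (simp add: T)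
  have \<tau>_contQ: "continuous_map ?P (top_of_set V) (\<lambda>(g, x). \<tau> g x)"
  proof -
    \<comment> \<open>This is the inclusion of G x Q into G x V, written as a pair of projections;
      composing with it restricts \<tau> to the section.\<close>
    have "continuous_map ?P (prod_topology T (top_of_set V)) (\<lambda>p. (fst p, snd p))"
    proof (rule continuous_map_pairedI)
      show "continuous_map ?P T fst" by (rule continuous_map_fst)
      have "continuous_map (top_of_set Q) (top_of_set V) id"
        using Q by auto
      from continuous_map_compose[OF continuous_map_snd this]
      show "continuous_map ?P (top_of_set V) snd" by simp
    qed
    from continuous_map_compose[OF this \<tau>_cont] show ?thesis
      by (simp add: o_def case_prod_unfold)
  qed
  have L\<tau>_cont: "continuous_map ?P euclideanreal (\<lambda>(g, x). L (\<tau> g x))"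
    using continuous_map_compose[OF \<tau>_contQ, of euclideanreal L] L_cont
    by (simp add: o_def case_prod_unfold)
  have \<sigma>_cont: "continuous_map ?P (top_of_set {0<..}) (\<lambda>(g, x). \<sigma> g x)"
  proof -
    have "continuous_map ?P euclideanreal (\<lambda>(g, x). \<sigma> g x)"
      \<comment> \<open>Agreement on the topological space suffices: outside
        \<open>carrier G\<close> and Q the values of \<sigma> are unconstrained.\<close>
      using L\<tau>_cont by (rule continuous_map_eq) (auto simp: top \<sigma>_eq T)
    then show ?thesis
      using assms(6) by (auto simp: continuous_map_in_subtopology top T)
  qed
  have \<rho>_cont: "continuous_map ?P (top_of_set Q) (\<lambda>(g, x). \<rho> g x)"
  proof -
    have "continuous_map ?P euclideanreal (\<lambda>p. 1 / (case p of (g, x) \<Rightarrow> L (\<tau> g x)))"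
      using L\<tau>_cont L\<tau>_pos by (intro continuous_map_real_divide) (force simp: T)+
    \<comment> \<open>The codomain is enlarged from V to the whole space, where scalar
      multiplication is continuous; \<open>\<rho>_Q\<close> later cuts it down to Q.\<close>
    moreover have "continuous_map ?P euclidean (\<lambda>(g, x). \<tau> g x)"
      using \<tau>_contQ by (simp add: continuous_map_in_subtopology)
    ultimately have "continuous_map ?P euclidean
        (\<lambda>p. sc (of_real (1 / (case p of (g, x) \<Rightarrow> L (\<tau> g x)))) (case p of (g, x) \<Rightarrow> \<tau> g x))"
      by (rule continuous_map_scale[OF topological_linear_space_axioms])
    then have "continuous_map ?P euclidean (\<lambda>(g, x). \<rho> g x)"
      by (rule continuous_map_eq) (auto simp: T \<rho>_eq)
    then show ?thesis
      using \<rho>_Q by (auto simp: continuous_map_in_subtopology T)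
  qed
  show ?thesis
    unfolding multiplier_def continuous_action_def
    using \<rho>_cont \<rho>_one \<rho>_mult \<sigma>_cont cocycle by simp
qed

end
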